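(* Let $N>0$ be an integer. $N$-expansiveness is a conjugacy invariant: if $X^t$ and $Y^t$ are flows on compact metric spaces $M_1$ and $M_2$ respectively, $X^t$ and $Y^t$ are conjugate, and $Y^t$ is $N$-expansive, then $X^t$ is $N$-expansive.
   Context: A flow on a compact metric space $M$ is a family $X^t=\{X^t\}_{t\in\mathbb{R}}$ of homeomorphisms of $M$ with $X^0(x)=x$ and $X^{t+s}(x)=X^t(X^s(x))$ for all $x\in M$, $s,t\in\mathbb{R}$, such that $(t,x)\mapsto X^t(x)$ is continuous. For $I\subset\mathbb{R}$ and $B\subset M$, $X^{I}(B)=\{X^t(b): t\in I,\ b\in B\}$. Two flows $X^t$ on $M_1$ and $Y^t$ on $M_2$ are conjugate if there is a homeomorphism $h:M_1\to M_2$ mapping orbits of $X^t$ onto orbits of $Y^t$ (the orbit of $x$ under $X^t$ is $\{X^t(x):t\in\mathbb{R}\}$). Let $\mathrm{Hom}_0(\mathbb{R})$ be the set of homeomorphisms of $\mathbb{R}$ fixing $0$. For $A\subset M$, $\mathcal{H}(A)$ is the set of maps $\alpha:A\to \mathrm{Hom}_0(\mathbb{R})$ such that there is a point $x_\alpha\in A$ with $\alpha(x_\alpha)=\mathrm{id}_{\mathbb{R}}$, and such that for each $t\in\mathbb{R}$ the map $A\to\mathbb{R}$, $x\mapsto\alpha(x)(t)$, is continuous. For $t\in\mathbb{R}$ and $\alpha\in\mathcal{H}(A)$, put $\mathcal{X}^t_\alpha(A)=\{X^{\alpha(x)(t)}(x): x\in A\}$. $N$-expansive: for every $\epsilon>0$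 there is $\delta>0$ such that whenever $A\subset M$ and $\alpha\in\mathcal{H}(A)$ satisfy $\operatorname{diam}(\mathcal{X}^t_\alpha(A))<\delta$ for all $t\in\mathbb{R}$, there is a subset $B\subset A$ of cardinality less than $N+1$ with $A\subset X^{(-\epsilon,\epsilon)}(B)$. *)

theory Defs
  imports "HOL-Analysis.Analysis"
begin

text \<open>
  A space is a set \<open>M\<close> in a metric space type, and a flow on it is a total function
  \<open>X :: real \<Rightarrow> 'a \<Rightarrow> 'a\<close> whose values outside \<open>M\<close> are irrelevant.
\<close>

definition flow_on :: "'a::metric_space set \<Rightarrow> (real \<Rightarrow> 'a \<Rightarrow> 'a) \<Rightarrow> bool" where
  "flow_on M X \<longleftrightarrow>
     (\<forall>t. \<exists>g. homeomorphism M M (X t) g) \<and>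
     (\<forall>x\<in>M. X 0 x = x) \<and>
     (\<forall>x\<in>M. \<forall>s t. X (t + s) x = X t (X s x)) \<and>
     continuous_on (UNIV \<times> M) (\<lambda>(t, x). X t x)"

definition flow_image :: "(real \<Rightarrow> 'a \<Rightarrow> 'a) \<Rightarrow> real set \<Rightarrow> 'a set \<Rightarrow> 'a set" where
  "flow_image X I B = {X t b | t b. t \<in> I \<and> b \<in> B}"

definition flow_orbit :: "(real \<Rightarrow> 'a \<Rightarrow> 'a) \<Rightarrow> 'a \<Rightarrow> 'a set" where
  "flow_orbit X x = range (\<lambda>t. X t x)"

definition conjugate_flows ::
  "'a::metric_space set \<Rightarrow> (real \<Rightarrow> 'a \<Rightarrow> 'a) \<Rightarrow> 'b::metric_space set \<Rightarrow> (real \<Rightarrow> 'b \<Rightarrow> 'b) \<Rightarrow> bool" where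
  "conjugate_flows M1 X M2 Y \<longleftrightarrow>
     (\<exists>h k. homeomorphism M1 M2 h k \<and>
        (\<forall>x\<in>M1. \<exists>y\<in>M2. h ` flow_orbit X x = flow_orbit Y y))"

definition Hom0 :: "(real \<Rightarrow> real) set" where
  "Hom0 = {f. (\<exists>g. homeomorphism UNIV UNIV f g) \<and> f 0 = 0}"

text \<open>
  A map \<open>A \<rightarrow> Hom0\<close> is a total function of which only the values on \<open>A\<close> are used.
  Membership forces \<open>A\<close> to be nonempty.
\<close>

definition reparam_maps :: "'a::metric_space set \<Rightarrow> ('a \<Rightarrow> real \<Rightarrow> real) set" where
  "reparam_maps A = {\<alpha>. (\<forall>x\<in>A. \<alpha> x \<in> Hom0) \<and>
     (\<exists>x\<in>A. \<alpha> x = id) \<and>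
     (\<forall>t. continuous_on A (\<lambda>x. \<alpha> x t))}"

definition reparam_image ::
  "(real \<Rightarrow> 'a \<Rightarrow> 'a) \<Rightarrow> ('a \<Rightarrow> real \<Rightarrow> real) \<Rightarrow> 'a set \<Rightarrow> real \<Rightarrow> 'a set" where
  "reparam_image X \<alpha> A t = (\<lambda>x. X (\<alpha> x t) x) ` A"

text \<open>
  \<open>diameter\<close> is meaningful only for bounded sets; below it is applied to subsets of \<open>M\<close>,
  which is meant to be compact.
\<close>

definition N_expansive ::
  "nat \<Rightarrow> 'a::metric_space set \<Rightarrow> (real \<Rightarrow> 'a \<Rightarrow> 'a) \<Rightarrow> bool" where
  "N_expansive N M X \<longleftrightarrow>
     (\<forall>\<epsilon>>0. \<exists>\<delta>>0. \<forall>A \<alpha>.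
        A \<subseteq> M \<and> \<alpha> \<in> reparam_maps A \<and> (\<forall>t. diameter (reparam_image X \<alpha> A t) < \<delta>) \<longrightarrow>
        (\<exists>B\<subseteq>A. finite B \<and> card B < N + 1 \<and> A \<subseteq> flow_image X {-\<epsilon><..<\<epsilon>} B))"

end

theory Submission
  imports Defs
begin

text \<open>
  A homeomorphism \<open>h\<close> that maps orbits to orbits satisfies \<open>h (X t x) = Y (\<theta> t x) (h x)\<close> for some
  time change \<open>\<theta>\<close>; if \<open>\<theta>\<close> is jointly continuous and each \<open>\<theta> \<cdot> x\<close> is a homeomorphism of the line,
  then composing reparametrisations with \<open>\<theta>\<close> transports expansiveness. The difficulty is the
  continuity of \<open>\<theta>\<close>, since the topology of an orbit as a subset differs from that of the line.

  Away from points at rest there are no arbitrarily short periods, so on a small piece of the space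
  the relation of lying on a common short orbit segment is an equivalence relation. A short path
  inside one orbit is thereby partitioned into countably many closed sets, and Sierpinski's theorem
  leaves only one of them. Hence \<open>\<theta>\<close> exists and is continuous for short times, and the cocycle
  identity extends it to all times. At points at rest one may set \<open>\<theta> t x = t\<close>, because
  \<open>N\<close>-expansiveness makes these points isolated.
\<close>

subsection \<open>Flows and short periods\<close>

lemma flow_in: "flow_on M X \<Longrightarrow> x \<in> M \<Longrightarrow> X t x \<in> M"
  unfolding flow_on_def homeomorphism_def by blast

lemma flow_zero: "flow_on M X \<Longrightarrow> x \<in> M \<Longrightarrow> X 0 x = x"
  unfolding flow_on_def by blast

lemma flow_add: "flow_on M X \<Longrightarrow> x \<in> M \<Longrightarrow> X t (X s x) = X (t + s) x"
  unfolding flow_on_def by simp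

lemma flow_minus: "flow_on M X \<Longrightarrow> x \<in> M \<Longrightarrow> X (- t) (X t x) = x"
  using flow_add[of M X x "-t" t] by (simp add: flow_zero)

lemma flow_eq_iff:
  assumes "flow_on M X" "x \<in> M"
  shows "X s x = X t x \<longleftrightarrow> X (s - t) x = x"
proof
  assume "X s x = X t x"
  then have "X (- t) (X s x) = x" using flow_minus[OF assms, of t] by simp
  then show "X (s - t) x = x" using flow_add[OF assms, of "- t" s] by simp
next
  assume "X (s - t) x = x"
  then show "X s x = X t x" using flow_add[OF assms, of t "s - t"] by simp
qed

lemma continuous_on_flow:
  assumes "flow_on M X" "continuous_on S f" "continuous_on S g" "g ` S \<subseteq> M"
  shows "continuous_on S (\<lambda>z. X (f z) (g z))"
proof -
  have "continuous_on (UNIV \<times> M) (\<lambda>(t, x). X t x)"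
    using assms(1) unfolding flow_on_def by blast
  moreover have "continuous_on S (\<lambda>z. (f z, g z))"
    using assms by (intro continuous_intros)
  ultimately have "continuous_on S (\<lambda>z. (\<lambda>(t, x). X t x) (f z, g z))"
    by (rule continuous_on_compose2) (use assms(4) in auto)
  then show ?thesis by simp
qed

text \<open>The additive law makes \<open>X (- t)\<close> inverse to \<open>X t\<close>, so the
  homeomorphism clause follows from joint continuity.\<close>

lemma flow_onI:
  assumes "\<And>t x. x \<in> M \<Longrightarrow> X t x \<in> M" "\<And>x. x \<in> M \<Longrightarrow> X 0 x = x"
    and add: "\<And>s t x. x \<in> M \<Longrightarrow> X (t + s) x = X t (X s x)"
    and cont: "continuous_on (UNIV \<times> M) (\<lambda>(t, x). X t x)"
  shows "flow_on M X"
proof -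
  have c: "continuous_on M (X t)" for t
  proof -
    have "continuous_on M (\<lambda>x. (\<lambda>(t, x). X t x) (t, x))"
      by (rule continuous_on_compose2[OF cont]) (auto intro!: continuous_intros)
    then show ?thesis by simp
  qed
  have inv: "X t (X (- t) x) = x" if "x \<in> M" for t x
    using assms(2)[OF that] add[OF that, of t "- t"] by simp
  have "homeomorphism M M (X t) (X (- t))" for t
    by (rule homeomorphismI) (use assms(1) c inv[of _ t] inv[of _ "-t"] in auto)
  then show ?thesis
    unfolding flow_on_def using assms by blast
qed

definition rest_points :: "'a set \<Rightarrow> (real \<Rightarrow> 'a \<Rightarrow> 'a) \<Rightarrow> 'a set" where
  "rest_points M X = {x \<in> M. \<forall>t. X t x = x}"

lemma flow_period_multiple:
  assumes X: "flow_on M X" "x \<in> M" and p: "X t x = x"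
  shows "X (of_int k * t) x = x"
proof -
  have nat: "X (real n * t) x = x" for n
  proof (induction n)
    case (Suc n)
    have "X (real (Suc n) * t) x = X t (X (real n * t) x)"
      by (simp add: flow_add[OF X] algebra_simps)
    then show ?case using Suc p by simp
  qed (simp add: flow_zero[OF X])
  show ?thesis
  proof (cases "k \<ge> 0")
    case True
    then show ?thesis using nat[of "nat k"] by simp
  next
    case False
    then have k: "of_int k * t = - (real (nat (- k)) * t)" by simp
    show ?thesis
      using flow_minus[OF X, of "real (nat (- k)) * t"] unfolding k nat .
  qed
qed

text \<open>A limit of points with periods tending to zero is at rest, because every time is a limit
  of multiples of those periods.\<close>

lemma no_small_period:
  assumes M: "compact M" and X: "flow_on M X" and rest: "rest_points M X = {}"
  obtains \<tau> where "\<tau> > 0" "\<And>x t. x \<in> M \<Longrightarrow> t \<noteq> 0 \<Longrightarrow> \<bar>t\<bar> \<le> \<tau> \<Longrightarrow> X t x \<noteq> x"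
proof (rule ccontr)
  assume "\<not> thesis"
  then have "\<exists>x t. x \<in> M \<and> t \<noteq> 0 \<and> \<bar>t\<bar> \<le> inverse (real (Suc n)) \<and> X t x = x" for n
    by (metis inverse_positive_iff_positive of_nat_0_less_iff that zero_less_Suc)
  then obtain x t where x: "\<And>n. x n \<in> M" and t0: "\<And>n. t n \<noteq> 0"
    and t: "\<And>n. \<bar>t n\<bar> \<le> inverse (real (Suc n))" and p: "\<And>n. X (t n) (x n) = x n"
    by metis
  obtain l r where l: "l \<in> M" and r: "strict_mono (r :: nat \<Rightarrow> nat)" and lim: "(x \<circ> r) \<longlonglongrightarrow> l"
    using M x unfolding compact_def by metis
  have t_lim: "t \<longlonglongrightarrow> 0"
    by (rule tendsto_rabs_zero_cancel, rule tendsto_sandwich[OF _ _ tendsto_const LIMSEQ_inverse_real_of_nat])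
      (use t in auto)
  have "X s l = l" for s
  proof -
    \<comment> \<open>\<open>k n\<close> is a multiple of the period \<open>t n\<close> within
      distance |\<open>t n\<close>| of \<open>s\<close>. It therefore tends to \<open>s\<close>,
      while time \<open>k n\<close> fixes \<open>x n\<close>.\<close>
    define k where "k n = of_int \<lfloor>s / t n\<rfloor> * t n" for n
    have "\<bar>k n - s\<bar> \<le> \<bar>t n\<bar>" for n
    proof -
      have "k n - s = (of_int \<lfloor>s / t n\<rfloor> - s / t n) * t n"
        using t0[of n] by (simp add: k_def field_simps)
      moreover have "\<bar>of_int \<lfloor>s / t n\<rfloor> - s / t n\<bar> \<le> 1" by linarith
      ultimately show ?thesis
        by (metis abs_ge_zero abs_mult mult_left_le_one_le)
    qed
    then have "(\<lambda>n. k n - s) \<longlonglongrightarrow> 0"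
      by (intro Lim_null_comparison[OF _ tendsto_rabs_zero[OF t_lim]]) auto
    then have "k \<longlonglongrightarrow> s" using LIM_zero_iff by blast
    then have "(\<lambda>n. (k (r n), x (r n))) \<longlonglongrightarrow> (s, l)"
      using lim r LIMSEQ_subseq_LIMSEQ[of k s r] by (auto simp: o_def intro!: tendsto_Pair)
    moreover have "continuous_on (UNIV \<times> M) (\<lambda>(t, x). X t x)"
      using X unfolding flow_on_def by blast
    ultimately have "(\<lambda>n. (\<lambda>(t, x). X t x) (k (r n), x (r n))) \<longlonglongrightarrow> (\<lambda>(t, x). X t x) (s, l)"
      using continuous_on_tendsto_compose[of "UNIV \<times> M" "\<lambda>(t, x). X t x"
          "\<lambda>n. (k (r n), x (r n))" "(s, l)" sequentially] l x by auto
    moreover have "X (k n) (x n) = x n" for n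
      unfolding k_def using flow_period_multiple[OF X x p] .
    ultimately have "(\<lambda>n. x (r n)) \<longlonglongrightarrow> X s l" by simp
    then show ?thesis using lim LIMSEQ_unique unfolding o_def by blast
  qed
  then show False using l rest unfolding rest_points_def by blast
qed

subsection \<open>Lifting orbit-preserving maps to time changes\<close>

text \<open>Flow times of size at most \<open>w\<close> could add up to \<open>2 * w\<close>, but
  times between \<open>w\<close> and \<open>2 * w\<close> displace every point by a definite amount.
  On a path too small for such a displacement, "joined by a time at most \<open>w\<close>" is
  transitive. Its classes are closed and countably many, so there is only one.\<close>

lemma path_in_orbit_short:
  assumes M: "compact M" and X: "flow_on M X" and w: "w > 0"
    and per: "\<And>x t. x \<in> M \<Longrightarrow> t \<noteq> 0 \<Longrightarrow> \<bar>t\<bar> \<le> 2 * w \<Longrightarrow> X t x \<noteq> x"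
  obtains r where "r > 0"
    "\<And>c. continuous_on {0..1::real} c \<Longrightarrow> c ` {0..1} \<subseteq> M \<Longrightarrow>
       (\<And>t. t \<in> {0..1} \<Longrightarrow> c t \<in> flow_orbit X (c 0)) \<Longrightarrow>
       (\<And>t. t \<in> {0..1} \<Longrightarrow> dist (c t) (c 0) \<le> r) \<Longrightarrow> \<exists>u. \<bar>u\<bar> \<le> w \<and> c 1 = X u (c 0)"
proof -
  \<comment> \<open>The displacement is continuous on the compact set of pairs with \<open>w\<close>
    \<le> |\<open>u\<close>| \<le> \<open>2 * w\<close>. Its minimum is positive because no such
    time is a period.\<close>
  have "\<exists>m>0. \<forall>x\<in>M. \<forall>u. w \<le> \<bar>u\<bar> \<and> \<bar>u\<bar> \<le> 2 * w \<longrightarrow> m \<le> dist x (X u x)"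
  proof (cases "M = {}")
    case True
    then show ?thesis by (auto intro: exI[of _ 1])
  next
    case False
    define K where "K = ({-2*w..-w} \<union> {w..2*w}) \<times> M"
    have "compact K" "K \<noteq> {}" using M w False by (auto simp: K_def intro!: compact_Times)
    moreover have "continuous_on K (\<lambda>z. dist (snd z) (X (fst z) (snd z)))"
      by (intro continuous_intros continuous_on_flow[OF X]) (auto simp: K_def)
    ultimately obtain z where z: "z \<in> K"
      "\<And>z'. z' \<in> K \<Longrightarrow> dist (snd z) (X (fst z) (snd z)) \<le> dist (snd z') (X (fst z') (snd z'))"
      using continuous_attains_inf[of K "\<lambda>z. dist (snd z) (X (fst z) (snd z))"] by auto
    have "X (fst z) (snd z) \<noteq> snd z"
      using z(1) w by (intro per) (auto simp: K_def)
    moreover have "(u, x) \<in> K" if "x \<in> M" "w \<le> \<bar>u\<bar>" "\<bar>u\<bar> \<le> 2 * w" for u x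
      using that unfolding K_def by auto
    ultimately show ?thesis
      using z(2)[of "(u, x)" for u x]
      by (intro exI[of _ "dist (snd z) (X (fst z) (snd z))"]) fastforce
  qed
  then obtain m where m: "m > 0"
    "\<And>x u. x \<in> M \<Longrightarrow> w \<le> \<bar>u\<bar> \<Longrightarrow> \<bar>u\<bar> \<le> 2 * w \<Longrightarrow> m \<le> dist x (X u x)" by blast
  show thesis
  \<comment> \<open>Two points within \<open>m / 3\<close> of the start are at most
    \<open>2 * m / 3\<close> apart, which is less than \<open>m\<close>.\<close>
  proof (rule that[of "m / 3"])
    show "m / 3 > 0" using m by simp
    fix c :: "real \<Rightarrow> 'a"
    assume c: "continuous_on {0..1} c" and cM: "c ` {0..1} \<subseteq> M"
      and orb: "\<And>t. t \<in> {0..1} \<Longrightarrow> c t \<in> flow_orbit X (c 0)"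
      and d: "\<And>t. t \<in> {0..1} \<Longrightarrow> dist (c t) (c 0) \<le> m / 3"
    define R where "R t t' \<longleftrightarrow> (\<exists>u. \<bar>u\<bar> \<le> w \<and> c t' = X u (c t))" for t t'
    define cls where "cls t = {t' \<in> {0..1}. R t t'}" for t
    have refl: "R t t" if "t \<in> {0..1}" for t
      unfolding R_def using that cM w flow_zero[OF X, of "c t"] by (intro exI[of _ 0]) (auto simp: image_subset_iff)
    have sym: "R t' t" if "R t t'" "t \<in> {0..1}" for t t'
    proof -
      obtain u where "\<bar>u\<bar> \<le> w" "c t' = X u (c t)" using \<open>R t t'\<close> unfolding R_def by blast
      then show ?thesis unfolding R_def using that(2) cM
flow_minus[OF X, of "c t" u]
        by (intro exI[of _ "-u"]) (auto simp: image_subset_iff)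
    qed
    have trans: "R t t''" if "R t t'" "R t' t''" "t \<in> {0..1}" "t'' \<in> {0..1}" for t t' t''
    proof -
      obtain u v where u: "\<bar>u\<bar> \<le> w" "c t' = X u (c t)" and v: "\<bar>v\<bar> \<le> w" "c t'' = X v (c t')"
        using \<open>R t t'\<close> \<open>R t' t''\<close> unfolding R_def by blast
      have t: "c t \<in> M" using that cM by auto
      have e: "c t'' = X (v + u) (c t)" using u v flow_add[OF X t] by simp
      have "dist (c t) (c t'') < m"
        using d[OF that(3)] d[OF that(4)] dist_triangle2[of "c t" "c t''" "c 0"] m(1) by linarith
      then have "\<bar>v + u\<bar> \<le> w"
        using m(2)[OF t, of "v + u"] e u v by (smt (verit))
      then show ?thesis using e unfolding R_def by blast
    qed
    have "cls ` {0..1} = {{0..1}}"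
    proof (rule real_Sierpinski_lemma)
      have "\<exists>s. c t = X s (c 0)" if "t \<in> {0..1}" for t
        using orb[OF that] unfolding flow_orbit_def by auto
      then obtain s where s: "\<And>t. t \<in> {0..1} \<Longrightarrow> c t = X (s t) (c 0)" by metis
      \<comment> \<open>The times \<open>s\<close> are chosen pointwise, with no continuity. Cutting
        the line into slots of length \<open>w\<close> puts points of one slot in one class, so
        classes are indexed by integers.\<close>
      define n where "n t = \<lfloor>s t / w\<rfloor>" for t
      have nR: "R t t'" if "n t = n t'" "t \<in> {0..1}" "t' \<in> {0..1}" for t t'
      proof -
        have "\<bar>s t' / w - s t / w\<bar> \<le> 1" using that(1) unfolding n_def by linarith
        then have "\<bar>s t' - s t\<bar> \<le> w" using w
          by (simp add: diff_divide_distrib[symmetric] field_simps)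
        moreover have "c t' = X (s t' - s t) (c t)"
          using flow_add[OF X, of "c 0" "s t' - s t" "s t"] cM s[OF that(2)] s[OF that(3)]
          by (auto simp: image_subset_iff)
        ultimately show ?thesis unfolding R_def by blast
      qed
      have "cls t = (\<Union>t'\<in>{t' \<in> {0..1}. n t' = n t}. cls t')" if "t \<in> {0..1}" for t
      proof -
        have "cls t' \<subseteq> cls t" if "t' \<in> {0..1}" "n t' = n t" for t'
          using nR[of t t'] trans[of t t'] that \<open>t \<in> {0..1}\<close> unfolding cls_def by auto
        then show ?thesis using that by blast
      qed
      then have "cls ` {0..1} \<subseteq> range (\<lambda>k. \<Union>t'\<in>{t' \<in> {0..1}. n t' = k}. cls t')"
        by (intro image_subsetI range_eqI) blast
      then show "countable (cls ` {0..1})"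
        by (rule countable_subset) auto
      show "pairwise disjnt (cls ` {0..1})"
      proof (clarsimp simp: pairwise_def)
        fix t t' assume t: "0 \<le> t" "t \<le> 1" "0 \<le> t'" "t' \<le> 1" and ne: "cls t \<noteq> cls t'"
        show "disjnt (cls t) (cls t')"
        proof (rule ccontr)
          assume "\<not> disjnt (cls t) (cls t')"
          then obtain q where q: "q \<in> {0..1}" "R t q" "R t' q"
            unfolding disjnt_def cls_def by blast
          have "R t t'" "R t' t"
            using trans[OF q(2) sym[OF q(3)]] trans[OF q(3) sym[OF q(2)]] t by auto
          then have "cls t = cls t'"
            unfolding cls_def using trans[of t t'] trans[of t' t] t by auto
          then show False using ne by simp
        qed
      qed
      show "closed C \<and> C \<noteq> {}" if "C \<in> cls ` {0..1}" for C
      proof -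
        obtain t where t: "t \<in> {0..1}" "C = cls t" using \<open>C \<in> _\<close> by blast
        \<comment> \<open>A class is the preimage under \<open>c\<close> of a compact orbit segment,
          unlike the whole orbit, which may fail to be closed.\<close>
        have "compact ((\<lambda>u. X u (c t)) ` {-w..w})"
          by (intro compact_continuous_image continuous_on_flow[OF X] continuous_intros)
            (use cM t in auto)
        then have "closed ({0..1} \<inter> c -` ((\<lambda>u. X u (c t)) ` {-w..w}))"
          using c by (intro continuous_closed_preimage compact_imp_closed) auto
        also have "{0..1} \<inter> c -` ((\<lambda>u. X u (c t)) ` {-w..w}) = C"
          unfolding t(2) cls_def R_def by (auto simp: abs_le_iff)
        finally show ?thesis using refl t unfolding cls_def by auto
      qed
      show "\<Union> (cls ` {0..1}) = {0..1}"
        using refl unfolding cls_def by auto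
    qed auto
    then have "cls 0 = {0..1}" by auto
    then have "1 \<in> cls 0" by simp
    then show "\<exists>u. \<bar>u\<bar> \<le> w \<and> c 1 = X u (c 0)" unfolding cls_def R_def by simp
  qed
qed

text \<open>Uniform continuity on the compact set \<open>{-1..1} \<times> M\<close> compares
  \<open>F t x\<close> with \<open>F 0 x\<close>, which vanishes.\<close>

lemma uniformly_small_near_zero:
  fixes F :: "real \<Rightarrow> 'a::metric_space \<Rightarrow> real"
  assumes M: "compact M" and F: "continuous_on (UNIV \<times> M) (\<lambda>(t, x). F t x)"
    and z: "\<And>x. x \<in> M \<Longrightarrow> F 0 x = 0" and e: "e > 0"
  obtains d where "d > 0" "\<And>t x. \<bar>t\<bar> \<le> d \<Longrightarrow> x \<in> M \<Longrightarrow> \<bar>F t x\<bar> < e"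
proof -
  have "uniformly_continuous_on ({-1..1} \<times> M) (\<lambda>(t, x). F t x)"
    using M by (intro compact_uniformly_continuous continuous_on_subset[OF F] compact_Times) auto
  then obtain d where d: "d > 0" "\<And>p q. p \<in> {-1..1} \<times> M \<Longrightarrow> q \<in> {-1..1} \<times> M \<Longrightarrow> dist q p < d \<Longrightarrow>
      dist ((\<lambda>(t, x). F t x) q) ((\<lambda>(t, x). F t x) p) < e"
    using e unfolding uniformly_continuous_on_def by metis
  show thesis
  proof (rule that[of "min 1 (d / 2)"])
    show "\<bar>F t x\<bar> < e" if "\<bar>t\<bar> \<le> min 1 (d / 2)" "x \<in> M" for t x
      using d(2)[of "(0, x)" "(t, x)"] that z[of x] d(1)
      by (auto simp: dist_Pair_Pair dist_real_def abs_le_iff)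
  qed (use d in auto)
qed

text \<open>The difference of two lifts is always a return time of \<open>z\<close>. By
  connectedness it cannot leave 0 without taking small nonzero values, and these are not
  periods.\<close>

lemma unique_lift:
  fixes f g :: "real \<Rightarrow> real"
  assumes M: "compact M" and Y: "flow_on M Y" and rest: "rest_points M Y = {}" and z: "z \<in> M"
    and S: "connected S" and f: "continuous_on S f" and g: "continuous_on S g"
    and eq: "\<And>s. s \<in> S \<Longrightarrow> Y (f s) z = Y (g s) z"
    and a: "a \<in> S" "f a = g a" and s: "s \<in> S"
  shows "f s = g s"
proof (rule ccontr)
  assume ne: "f s \<noteq> g s"
  obtain \<tau> where \<tau>: "\<tau> > 0" "\<And>x t. x \<in> M \<Longrightarrow> t \<noteq> 0 \<Longrightarrow> \<bar>t\<bar> \<le> \<tau> \<Longrightarrow> Y t x \<noteq> x"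
    using no_small_period[OF M Y rest] by metis
  define D where "D s = \<bar>f s - g s\<bar>" for s
  have "connected (D ` S)"
    unfolding D_def by (intro connected_continuous_image continuous_intros f g S)
  moreover have "0 \<in> D ` S" "D s \<in> D ` S"
    using a s unfolding D_def by force+
  ultimately have "{0..D s} \<subseteq> D ` S"
    by (rule connected_contains_Icc)
  \<comment> \<open>This intermediate value is nonzero, yet at most \<open>\<tau>\<close>, hence no
    return time.\<close>
  moreover have "min \<tau> (D s) \<in> {0..D s}" using \<tau>(1) unfolding D_def by auto
  ultimately obtain q where q: "q \<in> S" "D q = min \<tau> (D s)" by fastforce
  have "D s > 0" using ne unfolding D_def by simp
  then have "Y (f q - g q) z \<noteq> z"
    using q \<tau>(1) unfolding D_def by (intro \<tau>(2) z) auto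
  then show False using eq[OF q(1)] flow_eq_iff[OF Y z] by blast
qed

section \<open>Continuous time lifts, first for short times and then for all times\<close>

locale orbit_map =
  fixes M1 :: "'a::metric_space set" and X :: "real \<Rightarrow> 'a \<Rightarrow> 'a"
    and M2 :: "'b::metric_space set" and Y :: "real \<Rightarrow> 'b \<Rightarrow> 'b" and h :: "'a \<Rightarrow> 'b"
  assumes M1: "compact M1" and M2: "compact M2" and X: "flow_on M1 X" and Y: "flow_on M2 Y"
    and rest: "rest_points M2 Y = {}"
    and h: "continuous_on M1 h" and hM: "\<And>x. x \<in> M1 \<Longrightarrow> h x \<in> M2"
    and orb: "\<And>x t. x \<in> M1 \<Longrightarrow> h (X t x) \<in> flow_orbit Y (h x)"
begin

text \<open>Short orbit segments have images small enough for \<open>path_in_orbit_short\<close>,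
  which supplies a time of size at most \<open>w\<close>. That time is unique, so its graph is a
  closed condition in a compact set, and a function with compact graph is continuous.\<close>

lemma local_lift:
  obtains \<eta> \<theta> where "\<eta> > 0" "continuous_on ({-\<eta>..\<eta>} \<times> M1) (\<lambda>(t, x). \<theta> t x)"
    "\<And>x. x \<in> M1 \<Longrightarrow> \<theta> 0 x = 0"
    "\<And>x t. x \<in> M1 \<Longrightarrow> \<bar>t\<bar> \<le> \<eta> \<Longrightarrow> h (X t x) = Y (\<theta> t x) (h x)"
proof -
  obtain \<tau> where \<tau>: "\<tau> > 0" "\<And>x t. x \<in> M2 \<Longrightarrow> t \<noteq> 0 \<Longrightarrow> \<bar>t\<bar> \<le> \<tau> \<Longrightarrow> Y t x \<noteq> x"
    using no_small_period[OF M2 Y rest] by metis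
  \<comment> \<open>Halving \<open>\<tau>\<close> keeps the difference of two candidate times below
    the smallest period.\<close>
  define w where "w = \<tau> / 2"
  have w: "w > 0" "\<And>x t. x \<in> M2 \<Longrightarrow> t \<noteq> 0 \<Longrightarrow> \<bar>t\<bar> \<le> 2 * w \<Longrightarrow> Y t x \<noteq> x"
    using \<tau> unfolding w_def by auto
  obtain r where r: "r > 0" "\<And>c. continuous_on {0..1::real} c \<Longrightarrow> c ` {0..1} \<subseteq> M2 \<Longrightarrow>
       (\<And>t. t \<in> {0..1} \<Longrightarrow> c t \<in> flow_orbit Y (c 0)) \<Longrightarrow>
       (\<And>t. t \<in> {0..1} \<Longrightarrow> dist (c t) (c 0) \<le> r) \<Longrightarrow> \<exists>u. \<bar>u\<bar> \<le> w \<and> c 1 = Y u (c 0)"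
  proof (rule path_in_orbit_short[OF M2 Y w(1)])
    show "Y t x \<noteq> x" if "x \<in> M2" "t \<noteq> 0" "\<bar>t\<bar> \<le> 2 * w" for x t
      using w(2) that by blast
  qed blast
  obtain \<eta> where \<eta>: "\<eta> > 0" "\<And>t x. \<bar>t\<bar> \<le> \<eta> \<Longrightarrow> x \<in> M1 \<Longrightarrow> \<bar>dist (h (X t x)) (h x)\<bar> < r"
  proof (rule uniformly_small_near_zero[OF M1 _ _ r(1), of "\<lambda>t x. dist (h (X t x)) (h x)"])
    show "continuous_on (UNIV \<times> M1) (\<lambda>(t, x). dist (h (X t x)) (h x))"
      unfolding case_prod_unfold
      by (intro continuous_intros continuous_on_compose2[OF h] continuous_on_flow[OF X])
        (auto simp: flow_in[OF X])
  qed (auto simp: flow_zero[OF X])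
  have ex: "\<exists>u. \<bar>u\<bar> \<le> w \<and> h (X t x) = Y u (h x)" if t: "\<bar>t\<bar> \<le> \<eta>" and x: "x \<in> M1" for t x
  proof -
    \<comment> \<open>The image of the orbit segment from \<open>x\<close> to \<open>X t x\<close>,
      rescaled to the unit interval; this also covers negative \<open>t\<close>.\<close>
    define c where "c v = h (X (v * t) x)" for v
    have c0: "c 0 = h x" unfolding c_def using x by (simp add: flow_zero[OF X])
    have "\<exists>u. \<bar>u\<bar> \<le> w \<and> c 1 = Y u (c 0)"
    proof (rule r(2))
      show "continuous_on {0..1} c" unfolding c_def
        by (intro continuous_on_compose2[OF h] continuous_on_flow[OF X] continuous_intros)
          (use x in \<open>auto simp: flow_in[OF X]\<close>)
      show "c ` {0..1} \<subseteq> M2" unfolding c_def using x by (auto intro: hM simp: flow_in[OF X])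
      show "c v \<in> flow_orbit Y (c 0)" for v unfolding c0 unfolding c_def using orb[OF x] .
      show "dist (c v) (c 0) \<le> r" if "v \<in> {0..1}" for v
      proof -
        have "\<bar>v * t\<bar> \<le> \<eta>" using that t
          by (simp add: abs_mult) (meson abs_ge_zero mult_left_le_one_le order_trans)
        then show ?thesis unfolding c0 unfolding c_def using \<eta>(2)[of "v * t" x] x by auto
      qed
    qed
    then show ?thesis unfolding c0 by (simp add: c_def)
  qed
  then obtain \<theta> where \<theta>: "\<And>t x. \<bar>t\<bar> \<le> \<eta> \<Longrightarrow> x \<in> M1 \<Longrightarrow> \<bar>\<theta> t x\<bar> \<le> w"
    "\<And>t x. \<bar>t\<bar> \<le> \<eta> \<Longrightarrow> x \<in> M1 \<Longrightarrow> h (X t x) = Y (\<theta> t x) (h x)" by metis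
  have uniq: "u = \<theta> t x" if "\<bar>t\<bar> \<le> \<eta>" "x \<in> M1" "\<bar>u\<bar> \<le> w" "h (X t x) = Y u (h x)" for u t x
  proof -
    have "Y (u - \<theta> t x) (h x) = h x"
      unfolding flow_eq_iff[OF Y hM[OF that(2)], symmetric] using that(4) \<theta>(2)[OF that(1,2)] by simp
    moreover have "\<bar>u - \<theta> t x\<bar> \<le> 2 * w" using that(3) \<theta>(1)[OF that(1,2)] by linarith
    ultimately show ?thesis using w(2)[OF hM[OF that(2)], of "u - \<theta> t x"] by auto
  qed
  define D where "D = ({-\<eta>..\<eta>} \<times> M1) \<times> {-w..w}"
  \<comment> \<open>By uniqueness this solution set is exactly the graph of
    \<open>\<theta>\<close>.\<close>
  define K where "K = {z \<in> D. dist (h (X (fst (fst z)) (snd (fst z)))) (Y (snd z) (h (snd (fst z)))) = 0}"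
  have KI: "((t, x), u) \<in> K \<longleftrightarrow> \<bar>t\<bar> \<le> \<eta> \<and> x \<in> M1 \<and> u = \<theta> t x" for t x u
    using uniq[of t x u] \<theta>[of t x] unfolding K_def D_def by (auto simp: abs_le_iff)
  have "continuous_on D (\<lambda>z. dist (h (X (fst (fst z)) (snd (fst z)))) (Y (snd z) (h (snd (fst z)))))"
  proof (intro continuous_on_dist)
    show "continuous_on D (\<lambda>z. h (X (fst (fst z)) (snd (fst z))))"
      by (intro continuous_on_compose2[OF h] continuous_on_flow[OF X] continuous_intros)
        (auto simp: D_def flow_in[OF X])
    have "continuous_on D (\<lambda>z. h (snd (fst z)))"
      by (intro continuous_on_compose2[OF h] continuous_intros) (auto simp: D_def)
    then show "continuous_on D (\<lambda>z. Y (snd z) (h (snd (fst z))))"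
      by (intro continuous_on_flow[OF Y] continuous_intros) (auto simp: D_def hM)
  qed
  then have "closedin (top_of_set D) K"
    unfolding K_def by (rule continuous_closedin_preimage_constant)
  moreover have "compact D" unfolding D_def using M1 by (intro compact_Times) auto
  ultimately have "compact K" by (rule closedin_compact[rotated])
  \<comment> \<open>The projection \<open>fst\<close> is a continuous injection on the compact
    graph, so its inverse, which sends \<open>p\<close> to \<open>p\<close> paired with its lift, is
    continuous.\<close>
  then have "continuous_on (fst ` K) (\<lambda>p. (p, (\<lambda>(t, x). \<theta> t x) p))"
    by (intro continuous_on_inv continuous_intros) (auto simp: KI)
  moreover have "fst ` K = {-\<eta>..\<eta>} \<times> M1"
  proof
    show "fst ` K \<subseteq> {-\<eta>..\<eta>} \<times> M1" by (auto simp: KI abs_le_iff)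
    show "{-\<eta>..\<eta>} \<times> M1 \<subseteq> fst ` K"
    proof
      fix p assume "p \<in> {-\<eta>..\<eta>} \<times> M1"
      then have "(p, \<theta> (fst p) (snd p)) \<in> K"
        using KI[of "fst p" "snd p"] by (auto simp: abs_le_iff)
      then show "p \<in> fst ` K" by force
    qed
  qed
  ultimately have "continuous_on ({-\<eta>..\<eta>} \<times> M1) (\<lambda>p. snd (p, (\<lambda>(t, x). \<theta> t x) p))"
    by (intro continuous_on_snd) simp
  then have "continuous_on ({-\<eta>..\<eta>} \<times> M1) (\<lambda>(t, x). \<theta> t x)" by simp
  moreover have "\<theta> 0 x = 0" if "x \<in> M1" for x
    using uniq[of 0 x 0] that w(1) \<eta>(1) by (simp add: flow_zero[OF X] flow_zero[OF Y] hM)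
  ultimately show thesis using that \<eta>(1) \<theta>(2) by blast
qed

text \<open>The cocycle identity doubles the range of times on which a lift is valid. By
  \<open>unique_lift\<close> the successive lifts agree where both are valid, so they glue to one
  continuous lift.\<close>

lemma global_lift:
  obtains \<theta> where "continuous_on (UNIV \<times> M1) (\<lambda>(t, x). \<theta> t x)" "\<And>x. x \<in> M1 \<Longrightarrow> \<theta> 0 x = 0"
    "\<And>x t. x \<in> M1 \<Longrightarrow> h (X t x) = Y (\<theta> t x) (h x)"
proof -
  obtain \<eta> \<theta>0 where \<eta>: "\<eta> > 0" and c0: "continuous_on ({-\<eta>..\<eta>} \<times> M1) (\<lambda>(t, x). \<theta>0 t x)"
    and z0: "\<And>x. x \<in> M1 \<Longrightarrow> \<theta>0 0 x = 0"
    and l0: "\<And>x t. x \<in> M1 \<Longrightarrow> \<bar>t\<bar> \<le> \<eta> \<Longrightarrow> h (X t x) = Y (\<theta>0 t x) (h x)"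
    using local_lift by metis
  have "\<exists>\<theta>. continuous_on (UNIV \<times> M1) (\<lambda>(t, x). \<theta> t x) \<and> (\<forall>x\<in>M1. \<theta> 0 x = 0) \<and>
      (\<forall>x\<in>M1. \<forall>t. \<bar>t\<bar> \<le> 2 ^ n * \<eta> \<longrightarrow> h (X t x) = Y (\<theta> t x) (h x))" for n
  proof (induction n)
    case 0
    \<comment> \<open>Clamping time to \<open>{-\<eta>..\<eta>}\<close> gives a continuous function
      on the whole line; it has to lift only on the original interval.\<close>
    have "continuous_on (UNIV \<times> M1) (\<lambda>p. (\<lambda>(t, x). \<theta>0 t x) (max (-\<eta>) (min \<eta> (fst p)), snd p))"
      by (rule continuous_on_compose2[OF c0]) (use \<eta> in \<open>auto intro!: continuous_intros\<close>)
    then have "continuous_on (UNIV \<times> M1) (\<lambda>(t, x). \<theta>0 (max (-\<eta>) (min \<eta> t)) x)"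
      by (simp add: case_prod_unfold)
    then show ?case
      by (rule_tac exI[of _ "\<lambda>t. \<theta>0 (max (-\<eta>) (min \<eta> t))"])
        (use \<eta> z0 l0 in \<open>auto simp: abs_le_iff min_def max_def\<close>)
  next
    case (Suc n)
    then obtain f where f: "continuous_on (UNIV \<times> M1) (\<lambda>(t, x). f t x)" "\<And>x. x \<in> M1 \<Longrightarrow> f 0 x = 0"
      "\<And>x t. x \<in> M1 \<Longrightarrow> \<bar>t\<bar> \<le> 2 ^ n * \<eta> \<Longrightarrow> h (X t x) = Y (f t x) (h x)" by auto
    \<comment> \<open>Time \<open>t\<close> is run in two halves, and the lifted times of the halves
      add.\<close>
    define g where "g t x = f (t / 2) (X (t / 2) x) + f (t / 2) x" for t x
    have fc: "continuous_on S (\<lambda>z. f (u z) (v z))"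
      if "continuous_on S u" "continuous_on S v" "v ` S \<subseteq> M1" for S and u :: "real \<times> 'a \<Rightarrow> real" and v
    proof -
      have "continuous_on S (\<lambda>z. (\<lambda>(t, x). f t x) (u z, v z))"
        by (rule continuous_on_compose2[OF f(1)]) (use that in \<open>auto intro!: continuous_intros\<close>)
      then show ?thesis by simp
    qed
    have "continuous_on (UNIV \<times> M1) (\<lambda>(t, x). g t x)"
      unfolding g_def case_prod_unfold
      by (intro continuous_intros fc continuous_on_flow[OF X]) (auto simp: flow_in[OF X])
    moreover have "h (X t x) = Y (g t x) (h x)" if x: "x \<in> M1" and t: "\<bar>t\<bar> \<le> 2 ^ Suc n * \<eta>" for t x
    proof -
      have t2: "\<bar>t / 2\<bar> \<le> 2 ^ n * \<eta>" using t by simp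
      have "h (X t x) = h (X (t / 2) (X (t / 2) x))" by (simp add: flow_add[OF X x])
      also have "\<dots> = Y (f (t / 2) (X (t / 2) x)) (h (X (t / 2) x))"
        using f(3)[OF flow_in[OF X x] t2] .
      also have "\<dots> = Y (g t x) (h x)"
        unfolding f(3)[OF x t2] g_def by (simp add: flow_add[OF Y hM[OF x]])
      finally show ?thesis .
    qed
    moreover have "g 0 x = 0" if "x \<in> M1" for x
      using that by (simp add: g_def f(2) flow_zero[OF X])
    ultimately show ?case by blast
  qed
  then obtain \<Theta> where \<Theta>: "\<And>n. continuous_on (UNIV \<times> M1) (\<lambda>(t, x). \<Theta> n t x)"
    "\<And>n x. x \<in> M1 \<Longrightarrow> \<Theta> n 0 x = 0"
    "\<And>n x t. x \<in> M1 \<Longrightarrow> \<bar>t\<bar> \<le> 2 ^ n * \<eta> \<Longrightarrow> h (X t x) = Y (\<Theta> n t x) (h x)" by metis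
  have eq: "\<Theta> n t x = \<Theta> m t x" if x: "x \<in> M1" and t: "\<bar>t\<bar> \<le> 2 ^ n * \<eta>" "\<bar>t\<bar> \<le> 2 ^ m * \<eta>" for n m t x
  proof (rule unique_lift[OF M2 Y rest hM[OF x], where S = "{-\<bar>t\<bar>..\<bar>t\<bar>}" and a = 0
      and f = "\<lambda>t. \<Theta> n t x" and g = "\<lambda>t. \<Theta> m t x"])
    show "connected {-\<bar>t\<bar>..\<bar>t\<bar>}" by simp
    have c: "continuous_on {-\<bar>t\<bar>..\<bar>t\<bar>} (\<lambda>s. \<Theta> n s x)" for n
    proof -
      have "continuous_on {-\<bar>t\<bar>..\<bar>t\<bar>} (\<lambda>s. (\<lambda>(t, x). \<Theta> n t x) (s, x))"
        by (rule continuous_on_compose2[OF \<Theta>(1)]) (use x in \<open>auto intro!: continuous_intros\<close>)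
      then show ?thesis by simp
    qed
    show "continuous_on {-\<bar>t\<bar>..\<bar>t\<bar>} (\<lambda>s. \<Theta> n s x)" "continuous_on {-\<bar>t\<bar>..\<bar>t\<bar>} (\<lambda>s. \<Theta> m s x)"
      by (rule c)+
    show "Y (\<Theta> n s x) (h x) = Y (\<Theta> m s x) (h x)" if "s \<in> {-\<bar>t\<bar>..\<bar>t\<bar>}" for s
      using \<Theta>(3)[OF x, of s n] \<Theta>(3)[OF x, of s m] that t by auto
    show "0 \<in> {-\<bar>t\<bar>..\<bar>t\<bar>}" "\<Theta> n 0 x = \<Theta> m 0 x" "t \<in> {-\<bar>t\<bar>..\<bar>t\<bar>}" using \<Theta>(2) x by auto
  qed
  define N where "N t = nat \<lceil>\<bar>t\<bar> / \<eta>\<rceil>" for t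
  have big: "t < 2 ^ n * \<eta>" if "nat \<lceil>t / \<eta>\<rceil> \<le> n" for t n
  proof -
    have "t / \<eta> \<le> real n" using that by linarith
    also have "\<dots> < 2 ^ n" by (rule of_nat_less_two_power)
    finally show ?thesis using \<eta> by (simp add: field_simps)
  qed
  have N: "\<bar>t\<bar> < 2 ^ N t * \<eta>" for t unfolding N_def by (rule big) simp
  define \<theta> where "\<theta> t x = \<Theta> (N t) t x" for t x
  show thesis
  proof (rule that[of \<theta>])
    show "\<theta> 0 x = 0" if "x \<in> M1" for x unfolding \<theta>_def by (rule \<Theta>(2)[OF that])
    show "h (X t x) = Y (\<theta> t x) (h x)" if "x \<in> M1" for t x
      unfolding \<theta>_def using \<Theta>(3)[OF that, of t "N t"] N[of t] by simp
    show "continuous_on (UNIV \<times> M1) (\<lambda>(t, x). \<theta> t x)"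
      unfolding continuous_on_def
    proof (clarsimp)
      fix t x assume x: "x \<in> M1"
      define U where "U = {-(2 ^ N t * \<eta>)<..<2 ^ N t * \<eta>} \<times> (UNIV :: 'a set)"
      have U: "open U" "(t, x) \<in> U" using N[of t] unfolding U_def by (auto intro!: open_Times)
      \<comment> \<open>On the left the index varies with the moving time; on the right it is frozen
        at the fixed time. On \<open>U\<close> both lifts are valid and hence equal.\<close>
      have "((\<lambda>(t, x). \<Theta> (N t) t x) \<longlongrightarrow> \<theta> t x) (at (t, x) within UNIV \<times> M1) \<longleftrightarrow>
        ((\<lambda>(s, x). \<Theta> (N t) s x) \<longlongrightarrow> \<theta> t x) (at (t, x) within UNIV \<times> M1)"
      proof (rule tendsto_cong)
        show "\<forall>\<^sub>F p in at (t, x) within UNIV \<times> M1. (case p of (t, x) \<Rightarrow> \<Theta> (N t) t x) = (case p of (s, x) \<Rightarrow> \<Theta> (N t) s x)"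
          unfolding eventually_at_topological
        proof (intro exI[of _ U] conjI U ballI impI)
          fix p assume "p \<in> U" "p \<in> UNIV \<times> M1"
          then have "snd p \<in> M1" "\<bar>fst p\<bar> \<le> 2 ^ N t * \<eta>" unfolding U_def by auto
          from eq[OF this(1) less_imp_le[OF N] this(2)]
          show "(case p of (t, x) \<Rightarrow> \<Theta> (N t) t x) = (case p of (s, x) \<Rightarrow> \<Theta> (N t) s x)"
            by (simp add: case_prod_unfold)
        qed
      qed
      moreover have "((\<lambda>(s, x). \<Theta> (N t) s x) \<longlongrightarrow> \<theta> t x) (at (t, x) within UNIV \<times> M1)"
        using \<Theta>(1)[of "N t"] x unfolding continuous_on_def \<theta>_def by force
      ultimately show "((\<lambda>(t, x). \<theta> t x) \<longlongrightarrow> \<theta> t x) (at (t, x) within UNIV \<times> M1)"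
        unfolding \<theta>_def by simp
    qed
  qed
qed

end

subsection \<open>Points at rest of an expansive flow\<close>

lemma diameter_leI:
  assumes "S \<noteq> {}" "\<And>x y. x \<in> S \<Longrightarrow> y \<in> S \<Longrightarrow> dist x y \<le> d"
  shows "diameter S \<le> d"
  unfolding diameter_def using assms by (auto intro!: cSUP_least)

lemma Hom0I:
  assumes "continuous_on UNIV f" "inj f" "surj f" "f 0 = 0"
  shows "f \<in> Hom0"
  using homeomorphism_into_1d[of UNIV f UNIV] assms unfolding Hom0_def by auto

lemma Hom0_id: "id \<in> Hom0"
  by (rule Hom0I) (auto simp: continuous_on_id id_def)

lemma Hom0_compose: "f \<in> Hom0 \<Longrightarrow> g \<in> Hom0 \<Longrightarrow> (\<lambda>t. f (g t)) \<in> Hom0"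
  unfolding Hom0_def using homeomorphism_compose[of UNIV UNIV g _ UNIV f] by (auto simp: o_def)

text \<open>A clock that lags by \<open>c\<close> before time \<open>-T\<close> and after time \<open>T\<close>.\<close>

lemma Hom0_delay:
  assumes c: "0 \<le> c" "c < T"
  shows "(\<lambda>t. t - c * min 1 (\<bar>t\<bar> / T)) \<in> Hom0" (is "?f \<in> _")
proof (rule Hom0I)
  have T: "T > 0" using c by simp
  show cont: "continuous_on UNIV ?f"
    using T by (intro continuous_intros) auto
  \<comment> \<open>The subtracted delay is Lipschitz with constant \<open>c / T\<close> < 1, so it
    cannot cancel the growth of \<open>t\<close>.\<close>
  have strict: "?f s < ?f t" if "s < t" for s t
  proof -
    have "\<bar>t\<bar> / T \<le> \<bar>s\<bar> / T + (t - s) / T"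
      using T that by (simp add: field_simps)
    then have "min 1 (\<bar>t\<bar> / T) - min 1 (\<bar>s\<bar> / T) \<le> (t - s) / T"
      using that T by (smt (verit) divide_nonneg_pos)
    then have "c * (min 1 (\<bar>t\<bar> / T) - min 1 (\<bar>s\<bar> / T)) \<le> c * ((t - s) / T)"
      using c by (intro mult_left_mono) auto
    also have "\<dots> = (c / T) * (t - s)" by simp
    also have "\<dots> < 1 * (t - s)"
      using c that by (intro mult_strict_right_mono) auto
    finally show ?thesis by (simp add: algebra_simps)
  qed
  then show "inj ?f" by (metis (mono_tags, lifting) linorder_injI less_irrefl)
  have "y \<in> range ?f" for y
  proof -
    have b: "0 \<le> c * min 1 (\<bar>t\<bar> / T)" "c * min 1 (\<bar>t\<bar> / T) \<le> c" for t
      using c T by (auto intro: mult_left_le)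
    \<comment> \<open>The delay lies between 0 and \<open>c\<close>, so the value \<open>y\<close>
      is attained between \<open>y\<close> and \<open>y + c\<close>.\<close>
    have "\<exists>t. y \<le> t \<and> t \<le> y + c \<and> ?f t = y"
      by (rule IVT') (use b[of y] b[of "y + c"] c in \<open>auto intro: continuous_on_subset[OF cont]\<close>)
    then show ?thesis by blast
  qed
  then show "surj ?f" by blast
qed simp

lemma rest_points_closed:
  assumes "compact M" "flow_on M X"
  shows "closed (rest_points M X)"
proof -
  have "rest_points M X = (\<Inter>t. {x \<in> M. dist (X t x) x = 0})"
    unfolding rest_points_def by auto
  moreover have "closed {x \<in> M. dist (X t x) x = 0}" for t
    by (intro continuous_closed_preimage_constant continuous_intros continuous_on_flow[OF assms(2)])
      (auto intro: compact_imp_closed assms)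
  ultimately show ?thesis by auto
qed

text \<open>Near a point at rest, orbit segments move so slowly that suitably delayed clocks keep
  finitely many points of one orbit close for all time. Hence expansiveness forces short periods
  there, and then all nearby orbits stay nearby for all time.\<close>

lemma N_expansive_rest_isolated:
  fixes M :: "'a::metric_space set"
  assumes M: "compact M" and Y: "flow_on M Y" and exp: "N_expansive N M Y"
    and p: "p \<in> rest_points M Y"
  obtains r where "r > 0" "\<And>x. x \<in> M \<Longrightarrow> dist x p < r \<Longrightarrow> x = p"
proof -
  have pM: "p \<in> M" and pY: "\<And>t. Y t p = p" using p unfolding rest_points_def by auto
  obtain \<delta> where \<delta>: "\<delta> > 0" "\<And>A \<alpha>. A \<subseteq> M \<Longrightarrow> \<alpha> \<in> reparam_maps A \<Longrightarrow>
      (\<And>t. diameter (reparam_image Y \<alpha> A t) < \<delta>) \<Longrightarrow>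
      \<exists>B\<subseteq>A. finite B \<and> card B < N + 1 \<and> A \<subseteq> flow_image Y {-1<..<1} B"
    using exp unfolding N_expansive_def by (metis zero_less_one)
  \<comment> \<open>\<open>T\<close> exceeds every delay \<open>2 * i\<close> with \<open>i\<close>
    \<le> \<open>N\<close>, and bounds the return times found below, which are at most
    \<open>2 * N\<close> plus an error below 1.\<close>
  define T where "T = 2 * real N + 1"
  have T: "T > 0" unfolding T_def by simp
  obtain \<rho> where \<rho>: "\<rho> > 0" "\<And>s x. x \<in> M \<Longrightarrow> \<bar>s\<bar> \<le> T \<Longrightarrow> dist x p < \<rho> \<Longrightarrow> dist (Y s x) p < \<delta> / 3"
  proof -
    have "continuous_on ({-T..T} \<times> M) (\<lambda>z. Y (fst z) (snd z))"
      by (intro continuous_on_flow[OF Y] continuous_intros) auto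
    then have "uniformly_continuous_on ({-T..T} \<times> M) (\<lambda>z. Y (fst z) (snd z))"
      using M by (intro compact_uniformly_continuous compact_Times) auto
    then obtain \<rho> where \<rho>: "\<rho> > 0" "\<And>a b. a \<in> {-T..T} \<times> M \<Longrightarrow> b \<in> {-T..T} \<times> M \<Longrightarrow> dist b a < \<rho> \<Longrightarrow>
        dist (Y (fst b) (snd b)) (Y (fst a) (snd a)) < \<delta> / 3"
      using \<delta>(1) unfolding uniformly_continuous_on_def by (metis divide_pos_pos zero_less_numeral)
    show thesis
    proof (rule that[OF \<rho>(1)])
      show "dist (Y s x) p < \<delta> / 3" if "x \<in> M" "\<bar>s\<bar> \<le> T" "dist x p < \<rho>" for s x
        using \<rho>(2)[of "(s, p)" "(s, x)"] that pM pY by (auto simp: dist_Pair_Pair abs_le_iff)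
    qed
  qed
  have small: "diameter S < \<delta>" if "S \<noteq> {}" "\<And>x. x \<in> S \<Longrightarrow> dist x p < \<delta> / 3" for S
  proof -
    have "dist x y \<le> 2 * \<delta> / 3" if "x \<in> S" "y \<in> S" for x y
      using dist_triangle2[of x y p] \<open>\<And>x. x \<in> S \<Longrightarrow> _\<close>[OF that(1)]
        \<open>\<And>x. x \<in> S \<Longrightarrow> _\<close>[OF that(2)] by linarith
    then have "diameter S \<le> 2 * \<delta> / 3" using that by (intro diameter_leI)
    then show ?thesis using \<delta>(1) by simp
  qed
  have periodic: "\<exists>u. u \<noteq> 0 \<and> \<bar>u\<bar> \<le> T \<and> Y u y = y" if y: "y \<in> M" "dist y p < \<rho>" for y
  proof -
    \<comment> \<open>These are \<open>N + 1\<close> points at time spacing 2, wider than the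
      tolerance 1: a relation \<open>a i = Y s (a j)\<close> with \<open>i\<close> \<noteq>
      \<open>j\<close> and |\<open>s\<close>| < 1 forces a nonzero return time.\<close>
    define a where "a i = Y (2 * real i) y" for i
    have "\<exists>i\<le>N. \<exists>j\<le>N. \<exists>s. i \<noteq> j \<and> \<bar>s\<bar> < 1 \<and> a i = Y s (a j)"
    proof (cases "inj_on a {..N}")
      case False
      then obtain i j where "i \<le> N" "j \<le> N" "i \<noteq> j" "a i = a j" unfolding inj_on_def by auto
      moreover have "Y 0 (a j) = a j" unfolding a_def by (rule flow_zero[OF Y flow_in[OF Y y(1)]])
      ultimately show ?thesis by (metis abs_zero zero_less_one)
    next
      case inj: True
      define A where "A = a ` {..N}"
      \<comment> \<open>The clock of \<open>a i\<close> loses precisely the head start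
        \<open>2 * i\<close> by time \<open>T\<close> in either direction, after which all points
        coincide. The point \<open>a 0\<close> keeps the identity clock.\<close>
      define \<alpha> where "\<alpha> z t = t - 2 * real (inv_into {..N} a z) * min 1 (\<bar>t\<bar> / T)" for z t
      have \<alpha>: "\<alpha> (a i) t = t - 2 * real i * min 1 (\<bar>t\<bar> / T)" if "i \<le> N" for i t
        unfolding \<alpha>_def using inj that by (simp add: inv_into_f_f)
      have AM: "A \<subseteq> M" unfolding A_def a_def using flow_in[OF Y y(1)] by auto
      have "finite A" unfolding A_def by simp
      have "\<alpha> \<in> reparam_maps A"
        unfolding reparam_maps_def
      proof (intro CollectI conjI ballI allI)
        fix z assume "z \<in> A"
        then obtain i where i: "i \<le> N" "z = a i" unfolding A_def by auto
        have "\<alpha> z = (\<lambda>t. t - 2 * real i * min 1 (\<bar>t\<bar> / T))" using i \<alpha> by auto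
        moreover have "2 * real i < T" using i unfolding T_def by simp
        ultimately show "\<alpha> z \<in> Hom0" using Hom0_delay[of "2 * real i" T] by simp
      next
        have "\<alpha> (a 0) = id" using \<alpha>[of 0] by auto
        then show "\<exists>x\<in>A. \<alpha> x = id" unfolding A_def by auto
      next
        show "continuous_on A (\<lambda>x. \<alpha> x t)" for t
          using \<open>finite A\<close> by (rule continuous_on_finite)
      qed
      moreover have "diameter (reparam_image Y \<alpha> A t) < \<delta>" for t
      proof -
        \<comment> \<open>\<open>g i\<close> is the total time elapsed from \<open>y\<close>: it
          equals \<open>t\<close> once |\<open>t\<close>| \<ge> \<open>T\<close>, and before that
          stays in \<open>{-T..T}\<close>, where the orbit is still near \<open>p\<close>.\<close>
        define g where "g i = t + 2 * real i * (1 - min 1 (\<bar>t\<bar> / T))" for i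
        have "Y (\<alpha> (a i) t) (a i) = Y (g i) y" if "i \<le> N" for i
          unfolding \<alpha>[OF that] unfolding a_def g_def
          by (simp add: flow_add[OF Y y(1)] algebra_simps)
        then have im: "reparam_image Y \<alpha> A t = (\<lambda>i. Y (g i) y) ` {..N}"
          unfolding reparam_image_def A_def image_image by auto
        show ?thesis
        proof (cases "\<bar>t\<bar> \<ge> T")
          case True
          then have "g i = t" for i unfolding g_def using T by simp
          then have "reparam_image Y \<alpha> A t = {Y t y}" unfolding im by auto
          then show ?thesis using \<delta>(1) by simp
        next
          case False
          have "\<bar>g i\<bar> \<le> T" if "i \<le> N" for i
          proof -
            have m: "min 1 (\<bar>t\<bar> / T) = \<bar>t\<bar> / T" "0 \<le> 1 - \<bar>t\<bar> / T" using False T by auto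
            have "2 * real i * (1 - \<bar>t\<bar> / T) \<le> T * (1 - \<bar>t\<bar> / T)"
              using m that unfolding T_def by (intro mult_right_mono) auto
            also have "\<dots> = T - \<bar>t\<bar>" using T by (simp add: field_simps)
            finally have "2 * real i * (1 - \<bar>t\<bar> / T) \<le> T - \<bar>t\<bar>" .
            moreover have "0 \<le> 2 * real i * (1 - \<bar>t\<bar> / T)" using m by simp
            ultimately show ?thesis unfolding g_def m(1) by linarith
          qed
          then show ?thesis unfolding im using \<rho>(2)[OF y(1) _ y(2)] by (intro small) auto
        qed
      qed
      ultimately obtain B where B: "B \<subseteq> A" "finite B" "card B < N + 1" "A \<subseteq> flow_image Y {-1<..<1} B"
        using \<delta>(2)[OF AM] by blast
      \<comment> \<open>A set \<open>B\<close> of at most \<open>N\<close> points misses some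
        \<open>a i\<close>, which must then lie within time 1 of another \<open>a j\<close>.\<close>
      have "card A = N + 1" unfolding A_def using inj by (simp add: card_image)
      then obtain z where z: "z \<in> A" "z \<notin> B" using B by (metis nat_neq_iff subsetI subset_antisym)
      then obtain s b where s: "z = Y s b" "b \<in> B" "\<bar>s\<bar> < 1"
        using B(4) unfolding flow_image_def by (auto simp: abs_less_iff)
      obtain i j where "i \<le> N" "z = a i" "j \<le> N" "b = a j" using z s B(1) unfolding A_def by auto
      then show ?thesis using s z by metis
    qed
    then obtain i j s where ij: "i \<le> N" "j \<le> N" "i \<noteq> j" "\<bar>s\<bar> < 1" "a i = Y s (a j)" by blast
    define u where "u = 2 * real i - (s + 2 * real j)"
    have "Y (2 * real i) y = Y (s + 2 * real j) y"
      using ij(5) unfolding a_def flow_add[OF Y y(1)] .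
    then have "Y u y = y" unfolding u_def using flow_eq_iff[OF Y y(1)] by blast
    moreover have "1 \<le> \<bar>real i - real j\<bar>" "\<bar>real i - real j\<bar> \<le> real N" using ij by linarith+
    then have "u \<noteq> 0" "\<bar>u\<bar> \<le> T" using ij(4) unfolding u_def T_def by linarith+
    ultimately show ?thesis by blast
  qed
  have stay: "dist (Y s y) p < \<delta> / 3" if y: "y \<in> M" "dist y p < \<rho>" for s y
  proof -
    obtain u where u: "u \<noteq> 0" "\<bar>u\<bar> \<le> T" "Y u y = y" using periodic[OF y] by blast
    \<comment> \<open>Reducing \<open>s\<close> modulo the period leaves a time of size at most
      \<open>T\<close>, where closeness to \<open>p\<close> is known.\<close>
    define v where "v = s - of_int \<lfloor>s / u\<rfloor> * u"
    have "v = (s / u - of_int \<lfloor>s / u\<rfloor>) * u" using u(1) by (simp add: v_def field_simps)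
    moreover have "\<bar>s / u - of_int \<lfloor>s / u\<rfloor>\<bar> \<le> 1" by linarith
    ultimately have "\<bar>v\<bar> \<le> \<bar>u\<bar>" by (metis abs_ge_zero abs_mult mult_left_le_one_le)
    then have "\<bar>v\<bar> \<le> T" using u(2) by linarith
    moreover have "Y s y = Y v (Y (of_int \<lfloor>s / u\<rfloor> * u) y)"
      unfolding flow_add[OF Y y(1)] v_def by simp
    then have "Y s y = Y v y" unfolding flow_period_multiple[OF Y y(1) u(3)] .
    ultimately show ?thesis using \<rho>(2)[OF y(1) _ y(2)] by simp
  qed
  \<comment> \<open>The entire neighbourhood now stays near \<open>p\<close> under identity clocks,
    so finitely many short orbit segments cover it.\<close>
  define A where "A = {x \<in> M. dist x p < \<rho>}"
  have pA: "p \<in> A" using pM \<rho>(1) unfolding A_def by simp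
  have "(\<lambda>_. id) \<in> reparam_maps A"
    unfolding reparam_maps_def using pA Hom0_id by auto
  moreover have "diameter (reparam_image Y (\<lambda>_. id) A t) < \<delta>" for t
    using pA stay by (intro small) (auto simp: reparam_image_def A_def)
  moreover have "A \<subseteq> M" unfolding A_def by blast
  ultimately obtain B where B: "B \<subseteq> A" "finite B" "A \<subseteq> flow_image Y {-1<..<1} B"
    using \<delta>(2)[of A "\<lambda>_. id"] by blast
  \<comment> \<open>The segments not based at \<open>p\<close> form a compact set avoiding
    \<open>p\<close>, as no other point can flow into a point at rest. Near \<open>p\<close> only
    the segment of \<open>p\<close> itself remains, and that is a single point.\<close>
  define V where "V = (\<lambda>z. Y (fst z) (snd z)) ` ({-1..1} \<times> (B - {p}))"
  have "compact ({-1..1::real} \<times> (B - {p}))"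
    using B(2) by (intro compact_Times finite_imp_compact[of "B - {p}"]) auto
  then have "compact V" unfolding V_def
    using B(1) \<open>A \<subseteq> M\<close>
    by (intro compact_continuous_image continuous_on_flow[OF Y] continuous_intros) auto
  moreover have "p \<notin> V"
  proof
    assume "p \<in> V"
    then obtain z where "z \<in> {-1..1} \<times> (B - {p})" "p = Y (fst z) (snd z)" unfolding V_def by blast
    then obtain s b where b: "p = Y s b" "b \<in> B" "b \<noteq> p" by (metis DiffE mem_Times_iff singletonI)
    then have "Y (- s) p = b" using flow_minus[OF Y, of b s] B(1) \<open>A \<subseteq> M\<close> by auto
    then show False using pY b(3) by simp
  qed
  ultimately obtain e where e: "e > 0" "ball p e \<subseteq> - V"
    using compact_imp_closed[of V] open_contains_ball[of "- V"] by auto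
  show thesis
  proof (rule that[of "min \<rho> e"])
    show "min \<rho> e > 0" using \<rho>(1) e(1) by simp
    fix x assume x: "x \<in> M" "dist x p < min \<rho> e"
    then have "x \<in> A" unfolding A_def by simp
    then obtain s b where b: "x = Y s b" "b \<in> B" "-1 < s" "s < 1"
      using B(3) unfolding flow_image_def by auto
    have "x \<notin> V" using e(2) x(2) by (auto simp: dist_commute)
    then have "b = p" using b unfolding V_def by force
    then show "x = p" using b pY by simp
  qed
qed

text \<open>Isolation gives each point at rest a ball meeting \<open>M\<close> in that point alone,
  so an open set is removed from a compact one.\<close>

lemma compact_minus_rest_points:
  assumes M: "compact M" and iso: "\<And>p. p \<in> rest_points M X \<Longrightarrow> \<exists>r>0. \<forall>x\<in>M. dist x p < r \<longrightarrow> x = p"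
  shows "compact (M - rest_points M X)"
proof -
  obtain r where r: "\<And>p. p \<in> rest_points M X \<Longrightarrow> r p > 0 \<and> (\<forall>x\<in>M. dist x p < r p \<longrightarrow> x = p)"
    using iso by metis
  have "M - rest_points M X = M - (\<Union>p\<in>rest_points M X. ball p (r p))"
    using r by (fastforce simp: dist_commute rest_points_def)
  then show ?thesis using M by (simp add: compact_diff open_UN)
qed

subsection \<open>Conjugacies\<close>

lemma flow_orbit_self: "flow_on M X \<Longrightarrow> x \<in> M \<Longrightarrow> x \<in> flow_orbit X x"
  unfolding flow_orbit_def using flow_zero by (metis rangeI)

lemma flow_orbit_subset: "flow_on M X \<Longrightarrow> x \<in> M \<Longrightarrow> flow_orbit X x \<subseteq> M"
  unfolding flow_orbit_def using flow_in by blast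

lemma flow_orbit_eq:
  assumes X: "flow_on M X" and x: "x \<in> M" and z: "z \<in> flow_orbit X x"
  shows "flow_orbit X z = flow_orbit X x"
proof -
  obtain s where s: "z = X s x" using z unfolding flow_orbit_def by blast
  have "X t x = X (t - s) z" "X t z = X (t + s) x" for t
    unfolding s flow_add[OF X x] by simp_all
  then show ?thesis unfolding flow_orbit_def by (metis (mono_tags, lifting) image_subset_iff rangeI subset_antisym)
qed

lemma rest_points_orbit:
  assumes "flow_on M X" "x \<in> M"
  shows "x \<in> rest_points M X \<longleftrightarrow> flow_orbit X x = {x}"
  unfolding rest_points_def flow_orbit_def using assms(2) by auto

text \<open>A point that flows into a point at rest was already there, as flowing back
  shows.\<close>

lemma flow_on_minus_rest_points:
  assumes X: "flow_on M X"
  shows "flow_on (M - rest_points M X) X"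
proof (rule flow_onI)
  fix x t assume x: "x \<in> M - rest_points M X"
  have "X t x \<notin> rest_points M X"
  proof
    assume *: "X t x \<in> rest_points M X"
    then have "X (- t) (X t x) = X t x" unfolding rest_points_def by blast
    then have "X t x = x" using flow_minus[OF X, of x t] x by simp
    then show False using * x by simp
  qed
  then show "X t x \<in> M - rest_points M X" using flow_in[OF X] x by blast
next
  have "continuous_on (UNIV \<times> M) (\<lambda>(t, x). X t x)" using X unfolding flow_on_def by blast
  then show "continuous_on (UNIV \<times> (M - rest_points M X)) (\<lambda>(t, x). X t x)"
    by (rule continuous_on_subset) auto
qed (use flow_zero[OF X] flow_add[OF X] in auto)

lemma rest_points_minus_rest_points: "rest_points (M - rest_points M X) X = {}"
  unfolding rest_points_def by auto

section \<open>Time changes of a conjugacy and their inverses\<close>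

locale flow_conjugacy =
  fixes M1 :: "'a::metric_space set" and X :: "real \<Rightarrow> 'a \<Rightarrow> 'a"
    and M2 :: "'b::metric_space set" and Y :: "real \<Rightarrow> 'b \<Rightarrow> 'b" and h k
  assumes M1: "compact M1" and M2: "compact M2" and X: "flow_on M1 X" and Y: "flow_on M2 Y"
    and hk: "homeomorphism M1 M2 h k"
    and orbit: "\<And>x. x \<in> M1 \<Longrightarrow> h ` flow_orbit X x = flow_orbit Y (h x)"
begin

lemma h_in: "x \<in> M1 \<Longrightarrow> h x \<in> M2" and k_in: "y \<in> M2 \<Longrightarrow> k y \<in> M1"
  and kh: "x \<in> M1 \<Longrightarrow> k (h x) = x" and hk_eq: "y \<in> M2 \<Longrightarrow> h (k y) = y"
  and h_cont: "continuous_on M1 h" and k_cont: "continuous_on M2 k"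
  using hk unfolding homeomorphism_def by auto

text \<open>The symmetry makes every result about \<open>h\<close> available for \<open>k\<close>,
  in particular a time change in the opposite direction.\<close>

lemma swap: "flow_conjugacy M2 Y M1 X k h"
proof
  fix y assume y: "y \<in> M2"
  have "k ` flow_orbit Y y = k ` h ` flow_orbit X (k y)"
    using orbit[OF k_in[OF y]] hk_eq[OF y] by simp
  also have "\<dots> = flow_orbit X (k y)"
    using kh flow_orbit_subset[OF X k_in[OF y]] by (force simp: image_image)
  finally show "k ` flow_orbit Y y = flow_orbit X (k y)" .
qed (use M1 M2 X Y hk homeomorphism_symD in auto)

text \<open>Being at rest means having a one-point orbit, which an injective map of orbits onto
  orbits preserves and reflects.\<close>

lemma rest_points_iff:
  assumes x: "x \<in> M1"
  shows "h x \<in> rest_points M2 Y \<longleftrightarrow> x \<in> rest_points M1 X"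
proof -
  have "h ` flow_orbit X x = {h x} \<longleftrightarrow> flow_orbit X x = {x}"
    using inj_on_image_eq_iff[of h M1 "flow_orbit X x" "{x}"] inj_on_inverseI[of M1 k h] kh
      flow_orbit_subset[OF X x] x by simp
  then show ?thesis
    unfolding rest_points_orbit[OF X x] rest_points_orbit[OF Y h_in[OF x]] orbit[OF x] by simp
qed

lemma image_minus_rest_points: "h ` (M1 - rest_points M1 X) = M2 - rest_points M2 Y"
proof
  show "h ` (M1 - rest_points M1 X) \<subseteq> M2 - rest_points M2 Y"
    using rest_points_iff h_in by blast
  show "M2 - rest_points M2 Y \<subseteq> h ` (M1 - rest_points M1 X)"
  proof
    fix y assume y: "y \<in> M2 - rest_points M2 Y"
    then have "k y \<in> M1 - rest_points M1 X" "h (k y) = y"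
      using rest_points_iff[of "k y"] k_in hk_eq by auto
    then show "y \<in> h ` (M1 - rest_points M1 X)" by (metis imageI)
  qed
qed

text \<open>The points at rest and their complement are disjoint closed sets, so the lift on the
  complement and the identity time on the points at rest combine continuously.\<close>

lemma time_change:
  assumes R1: "compact (M1 - rest_points M1 X)" and R2: "compact (M2 - rest_points M2 Y)"
  obtains \<theta> where "continuous_on (UNIV \<times> M1) (\<lambda>(t, x). \<theta> t x)" "\<And>x. x \<in> M1 \<Longrightarrow> \<theta> 0 x = 0"
    "\<And>x t. x \<in> M1 \<Longrightarrow> h (X t x) = Y (\<theta> t x) (h x)"
    "\<And>x t. x \<in> rest_points M1 X \<Longrightarrow> \<theta> t x = t"
proof -
  let ?R1 = "M1 - rest_points M1 X" and ?R2 = "M2 - rest_points M2 Y"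
  interpret R: orbit_map ?R1 X ?R2 Y h
  proof
    show "flow_on ?R1 X" "flow_on ?R2 Y" using X Y by (auto intro: flow_on_minus_rest_points)
    show "continuous_on ?R1 h" by (rule continuous_on_subset[OF h_cont]) auto
    show "h x \<in> ?R2" if "x \<in> ?R1" for x using image_minus_rest_points that by blast
    show "h (X t x) \<in> flow_orbit Y (h x)" if "x \<in> ?R1" for x t
      using orbit[of x] that unfolding flow_orbit_def by auto
  qed (use R1 R2 rest_points_minus_rest_points[of M2 Y] in auto)
  obtain f where f: "continuous_on (UNIV \<times> ?R1) (\<lambda>(t, x). f t x)" "\<And>x. x \<in> ?R1 \<Longrightarrow> f 0 x = 0"
    "\<And>x t. x \<in> ?R1 \<Longrightarrow> h (X t x) = Y (f t x) (h x)"
    using R.global_lift by metis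
  define \<theta> where "\<theta> t x = (if x \<in> rest_points M1 X then t else f t x)" for t x
  show thesis
  proof (rule that[of \<theta>])
    have "continuous_on (UNIV \<times> ?R1) (\<lambda>(t, x). \<theta> t x)"
      by (rule continuous_on_eq[OF f(1)]) (auto simp: \<theta>_def)
    moreover have "continuous_on (UNIV \<times> rest_points M1 X) (\<lambda>(t, x). \<theta> t x)"
      by (rule continuous_on_eq[OF continuous_on_fst[OF continuous_on_id]]) (auto simp: \<theta>_def)
    ultimately have "continuous_on (UNIV \<times> ?R1 \<union> UNIV \<times> rest_points M1 X) (\<lambda>(t, x). \<theta> t x)"
      using R1 rest_points_closed[OF M1 X]
      by (intro continuous_on_closed_Un closed_Times compact_imp_closed[OF R1]) auto
    moreover have "(UNIV :: real set) \<times> ?R1 \<union> UNIV \<times> rest_points M1 X = UNIV \<times> M1"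
      unfolding rest_points_def by auto
    ultimately show "continuous_on (UNIV \<times> M1) (\<lambda>(t, x). \<theta> t x)" by simp
    show "\<theta> 0 x = 0" if "x \<in> M1" for x using that f(2) unfolding \<theta>_def by simp
    show "\<theta> t x = t" if "x \<in> rest_points M1 X" for t x using that unfolding \<theta>_def by simp
    show "h (X t x) = Y (\<theta> t x) (h x)" if x: "x \<in> M1" for t x
    proof (cases "x \<in> rest_points M1 X")
      case True
      then have "h x \<in> rest_points M2 Y" using rest_points_iff[OF x] by simp
      then show ?thesis using True unfolding rest_points_def by simp
    qed (use f(3) x in \<open>simp add: \<theta>_def\<close>)
  qed
qed

text \<open>Off the points at rest, the composed time and \<open>t\<close> itself both lift the
  orbit of \<open>x\<close> through \<open>X\<close> and start at 0, so \<open>unique_lift\<close>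
  identifies them.\<close>

lemma time_change_inverse:
  assumes R1: "compact (M1 - rest_points M1 X)"
    and \<theta>: "continuous_on (UNIV \<times> M1) (\<lambda>(t, x). \<theta> t x)" "\<And>x. x \<in> M1 \<Longrightarrow> \<theta> 0 x = 0"
    "\<And>x t. x \<in> M1 \<Longrightarrow> h (X t x) = Y (\<theta> t x) (h x)"
    "\<And>x t. x \<in> rest_points M1 X \<Longrightarrow> \<theta> t x = t"
    and \<psi>: "continuous_on (UNIV \<times> M2) (\<lambda>(t, y). \<psi> t y)" "\<And>y. y \<in> M2 \<Longrightarrow> \<psi> 0 y = 0"
    "\<And>y t. y \<in> M2 \<Longrightarrow> k (Y t y) = X (\<psi> t y) (k y)"
    "\<And>y t. y \<in> rest_points M2 Y \<Longrightarrow> \<psi> t y = t"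
    and x: "x \<in> M1"
  shows "\<psi> (\<theta> t x) (h x) = t"
proof (cases "x \<in> rest_points M1 X")
  case True
  then show ?thesis using rest_points_iff[OF x] \<theta>(4) \<psi>(4) by simp
next
  case False
  have "continuous_on UNIV (\<lambda>t. (\<lambda>(t, x). \<theta> t x) (t, x))"
    by (rule continuous_on_compose2[OF \<theta>(1)]) (use x in \<open>auto intro!: continuous_intros\<close>)
  then have "continuous_on UNIV (\<lambda>t. \<theta> t x)" by simp
  then have "continuous_on UNIV (\<lambda>t. (\<lambda>(t, y). \<psi> t y) (\<theta> t x, h x))"
    by (intro continuous_on_compose2[OF \<psi>(1)] continuous_intros) (use x h_in in auto)
  then have c: "continuous_on UNIV (\<lambda>t. \<psi> (\<theta> t x) (h x))" by simp
  have "X (\<psi> (\<theta> t x) (h x)) x = X t x" for t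
  proof -
    have "X (\<psi> (\<theta> t x) (h x)) x = k (Y (\<theta> t x) (h x))"
      using \<psi>(3)[OF h_in[OF x]] kh[OF x] by simp
    also have "\<dots> = X t x"
      unfolding \<theta>(3)[OF x, symmetric] by (rule kh[OF flow_in[OF X x]])
    finally show ?thesis .
  qed
  then show ?thesis
    using unique_lift[OF R1 flow_on_minus_rest_points[OF X] rest_points_minus_rest_points, of x UNIV
        "\<lambda>t. \<psi> (\<theta> t x) (h x)" "\<lambda>t. t" 0 t] c False x \<theta>(2)[OF x] \<psi>(2)[OF h_in[OF x]] by auto
qed

end

section \<open>Transport of expansiveness along the time change\<close>

theorem theorem2:
  fixes N :: nat
    and M1 :: "'a::metric_space set" and X :: "real \<Rightarrow> 'a \<Rightarrow> 'a"
    and M2 :: "'b::metric_space set" and Y :: "real \<Rightarrow> 'b \<Rightarrow> 'b"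
  assumes "N > 0"
    and "compact M1" and "compact M2"
    and "flow_on M1 X" and "flow_on M2 Y"
    and "conjugate_flows M1 X M2 Y"
    and "N_expansive N M2 Y"
  shows "N_expansive N M1 X"
proof -
  note X = \<open>flow_on M1 X\<close> and Y = \<open>flow_on M2 Y\<close>
  obtain h k where hk: "homeomorphism M1 M2 h k"
    and orb: "\<And>x. x \<in> M1 \<Longrightarrow> \<exists>y\<in>M2. h ` flow_orbit X x = flow_orbit Y y"
    using assms(6) unfolding conjugate_flows_def by blast
  interpret C: flow_conjugacy M1 X M2 Y h k
  proof
    fix x assume x: "x \<in> M1"
    obtain y where y: "y \<in> M2" "h ` flow_orbit X x = flow_orbit Y y" using orb[OF x] by blast
    \<comment> \<open>Since \<open>h x\<close> lies on the image orbit, it can replace the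
      unspecified base point \<open>y\<close>.\<close>
    then have "h x \<in> flow_orbit Y y" using flow_orbit_self[OF X x] by blast
    then show "h ` flow_orbit X x = flow_orbit Y (h x)"
      using flow_orbit_eq[OF Y y(1)] y(2) by simp
  qed (use assms hk in auto)
  interpret D: flow_conjugacy M2 Y M1 X k h by (rule C.swap)
  have R2: "compact (M2 - rest_points M2 Y)"
    by (rule compact_minus_rest_points[OF assms(3)])
      (metis N_expansive_rest_isolated[OF assms(3) Y assms(7)])
  \<comment> \<open>Expansiveness of \<open>X\<close> is the goal, so compactness here is carried
    over from \<open>M2\<close> by \<open>k\<close>.\<close>
  have R1: "compact (M1 - rest_points M1 X)"
    unfolding D.image_minus_rest_points[symmetric]
    by (intro compact_continuous_image R2 continuous_on_subset[OF C.k_cont]) auto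
  obtain \<theta> where \<theta>: "continuous_on (UNIV \<times> M1) (\<lambda>(t, x). \<theta> t x)" "\<And>x. x \<in> M1 \<Longrightarrow> \<theta> 0 x = 0"
    "\<And>x t. x \<in> M1 \<Longrightarrow> h (X t x) = Y (\<theta> t x) (h x)"
    "\<And>x t. x \<in> rest_points M1 X \<Longrightarrow> \<theta> t x = t"
    using C.time_change[OF R1 R2] by blast
  obtain \<psi> where \<psi>: "continuous_on (UNIV \<times> M2) (\<lambda>(t, y). \<psi> t y)" "\<And>y. y \<in> M2 \<Longrightarrow> \<psi> 0 y = 0"
    "\<And>y t. y \<in> M2 \<Longrightarrow> k (Y t y) = X (\<psi> t y) (k y)"
    "\<And>y t. y \<in> rest_points M2 Y \<Longrightarrow> \<psi> t y = t"
    using D.time_change[OF R2 R1] by blast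
  have \<psi>\<theta>: "\<psi> (\<theta> t x) (h x) = t" if "x \<in> M1" for t x
    using C.time_change_inverse[OF R1 \<theta> \<psi> that] .
  have \<theta>\<psi>: "\<theta> (\<psi> t (h x)) x = t" if "x \<in> M1" for t x
    using D.time_change_inverse[OF R2 \<psi> \<theta> C.h_in[OF that], of t] C.kh[OF that] by simp
  have \<theta>_cont: "continuous_on S (\<lambda>z. \<theta> (u z) (v z))"
    if "continuous_on S u" "continuous_on S v" "v ` S \<subseteq> M1" for S :: "'c::topological_space set" and u v
  proof -
    have "continuous_on S (\<lambda>z. (\<lambda>(t, x). \<theta> t x) (u z, v z))"
      by (rule continuous_on_compose2[OF \<theta>(1)]) (use that in \<open>auto intro!: continuous_intros\<close>)
    then show ?thesis by simp
  qed
  show ?thesis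
    unfolding N_expansive_def
  proof (intro allI impI)
    fix \<epsilon> :: real assume \<epsilon>: "\<epsilon> > 0"
    \<comment> \<open>Times below \<open>\<epsilon>'\<close> for \<open>Y\<close> become times below
      \<open>\<epsilon>\<close> for \<open>X\<close>.\<close>
    obtain \<epsilon>' where \<epsilon>': "\<epsilon>' > 0" "\<And>t y. \<bar>t\<bar> \<le> \<epsilon>' \<Longrightarrow> y \<in> M2 \<Longrightarrow> \<bar>\<psi> t y\<bar> < \<epsilon>"
      using uniformly_small_near_zero[OF assms(3) \<psi>(1,2) \<epsilon>] by blast
    obtain \<delta>' where \<delta>': "\<delta>' > 0" "\<And>A \<alpha>. A \<subseteq> M2 \<Longrightarrow> \<alpha> \<in> reparam_maps A \<Longrightarrow>
      (\<And>t. diameter (reparam_image Y \<alpha> A t) < \<delta>') \<Longrightarrow>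
      \<exists>B\<subseteq>A. finite B \<and> card B < N + 1 \<and> A \<subseteq> flow_image Y {-\<epsilon>'<..<\<epsilon>'} B"
      using assms(7) \<epsilon>'(1) unfolding N_expansive_def by metis
    have "uniformly_continuous_on M1 h"
      by (rule compact_uniformly_continuous[OF C.h_cont assms(2)])
    then obtain \<delta> where \<delta>: "\<delta> > 0"
      "\<And>x x'. x \<in> M1 \<Longrightarrow> x' \<in> M1 \<Longrightarrow> dist x' x < \<delta> \<Longrightarrow> dist (h x') (h x) < \<delta>' / 2"
      using \<delta>'(1) unfolding uniformly_continuous_on_def by (metis half_gt_zero)
    show "\<exists>\<delta>>0. \<forall>A \<alpha>. A \<subseteq> M1 \<and> \<alpha> \<in> reparam_maps A \<and> (\<forall>t. diameter (reparam_image X \<alpha> A t) < \<delta>) \<longrightarrow>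
        (\<exists>B\<subseteq>A. finite B \<and> card B < N + 1 \<and> A \<subseteq> flow_image X {-\<epsilon><..<\<epsilon>} B)"
    proof (intro exI[of _ \<delta>] conjI allI impI \<delta>(1), elim conjE)
      fix A \<alpha> assume A: "A \<subseteq> M1" and \<alpha>: "\<alpha> \<in> reparam_maps A"
        and diam: "\<forall>t. diameter (reparam_image X \<alpha> A t) < \<delta>"
      obtain a where a: "a \<in> A" "\<alpha> a = id" using \<alpha> unfolding reparam_maps_def by blast
      have aM: "a \<in> M1" using a A by blast
      have kA: "k (h x) = x" if "x \<in> A" for x using C.kh that A by blast
      \<comment> \<open>The outer \<open>\<theta>\<close> turns the time of \<open>X\<close> at
        \<open>k y\<close> into time of \<open>Y\<close>. The inner \<open>\<psi>\<close> at the
        base point \<open>a\<close> undoes this there, so that \<open>\<beta> (h a)\<close> is the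
        identity.\<close>
      define \<beta> where "\<beta> y t = \<theta> (\<alpha> (k y) (\<psi> t (h a))) (k y)" for y t
      have \<theta>_homeo: "homeomorphism UNIV UNIV (\<lambda>t. \<theta> t x) (\<lambda>t. \<psi> t (h x))" if x: "x \<in> M1" for x
      proof (rule homeomorphismI)
        show "continuous_on UNIV (\<lambda>t. \<theta> t x)"
          using x by (intro \<theta>_cont continuous_intros) auto
        have "continuous_on UNIV (\<lambda>t. (\<lambda>(t, y). \<psi> t y) (t, h x))"
          by (rule continuous_on_compose2[OF \<psi>(1)])
            (use C.h_in[OF x] in \<open>auto intro!: continuous_intros\<close>)
        then show "continuous_on UNIV (\<lambda>t. \<psi> t (h x))" by simp
      qed (use \<psi>\<theta>[OF x] \<theta>\<psi>[OF x] in auto)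
      have "(\<lambda>t. \<theta> t x) \<in> Hom0" "(\<lambda>t. \<psi> t (h x)) \<in> Hom0" if "x \<in> M1" for x
        using \<theta>_homeo[OF that] homeomorphism_symD[OF \<theta>_homeo[OF that]] \<theta>(2)[OF that]
          \<psi>(2)[OF C.h_in[OF that]] unfolding Hom0_def by blast+
      note Hom0_times = this
      have "\<beta> \<in> reparam_maps (h ` A)"
        unfolding reparam_maps_def
      proof (intro CollectI conjI ballI allI)
        fix y assume "y \<in> h ` A"
        then obtain x where x: "x \<in> A" "y = h x" by blast
        have "\<alpha> x \<in> Hom0" using \<alpha> x(1) unfolding reparam_maps_def by blast
        then have "(\<lambda>t. \<alpha> x (\<psi> t (h a))) \<in> Hom0"
          by (rule Hom0_compose[OF _ Hom0_times(2)[OF aM]])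
        moreover have "(\<lambda>t. \<theta> t x) \<in> Hom0" using Hom0_times(1) x(1) A by blast
        ultimately have "(\<lambda>t. \<theta> (\<alpha> x (\<psi> t (h a))) x) \<in> Hom0"
          using Hom0_compose[of "\<lambda>t. \<theta> t x" "\<lambda>t. \<alpha> x (\<psi> t (h a))"] by simp
        moreover have "\<beta> y = (\<lambda>t. \<theta> (\<alpha> x (\<psi> t (h a))) x)"
          unfolding \<beta>_def x(2) kA[OF x(1)] ..
        ultimately show "\<beta> y \<in> Hom0" by simp
      next
        have "\<beta> (h a) = id"
          unfolding \<beta>_def kA[OF a(1)] a(2) using \<theta>\<psi>[OF aM] by auto
        then show "\<exists>y\<in>h ` A. \<beta> y = id" using a(1) by blast
      next
        fix t
        have hA: "h ` A \<subseteq> M2" using C.h_in A by blast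
        have kh: "continuous_on (h ` A) k" by (rule continuous_on_subset[OF C.k_cont hA])
        have "continuous_on A (\<lambda>x. \<alpha> x (\<psi> t (h a)))"
          using \<alpha> unfolding reparam_maps_def by blast
        then have "continuous_on (h ` A) (\<lambda>y. \<alpha> (k y) (\<psi> t (h a)))"
          by (rule continuous_on_compose2[OF _ kh]) (use kA in auto)
        then show "continuous_on (h ` A) (\<lambda>y. \<beta> y t)"
          unfolding \<beta>_def by (intro \<theta>_cont kh) (use kA A in auto)
      qed
      moreover have "diameter (reparam_image Y \<beta> (h ` A) t) < \<delta>'" for t
      proof -
        \<comment> \<open>The set for \<open>Y\<close> at time \<open>t\<close> is the
          \<open>h\<close>-image of the set for \<open>X\<close> at the single time
          \<open>\<psi> t (h a)\<close>, common to all points, so the diameter hypothesis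
          applies.\<close>
        let ?S = "reparam_image X \<alpha> A (\<psi> t (h a))"
        have SM: "?S \<subseteq> M1" unfolding reparam_image_def using A flow_in[OF X] by blast
        have "Y (\<beta> (h x) t) (h x) = h (X (\<alpha> x (\<psi> t (h a))) x)" if "x \<in> A" for x
          unfolding \<beta>_def kA[OF that] using \<theta>(3)[of x] that A by auto
        then have im: "reparam_image Y \<beta> (h ` A) t = h ` ?S"
          unfolding reparam_image_def image_image by auto
        have "dist x x' < \<delta>" if "x \<in> ?S" "x' \<in> ?S" for x x'
          using diameter_bounded_bound[OF bounded_subset[OF compact_imp_bounded[OF assms(2)] SM] that]
            diam by (meson le_less_trans)
        then have "dist y y' \<le> \<delta>' / 2" if "y \<in> h ` ?S" "y' \<in> h ` ?S" for y y'
          using that \<delta>(2) SM by (fastforce intro: less_imp_le)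
        then have "diameter (h ` ?S) \<le> \<delta>' / 2"
          using a(1) by (intro diameter_leI) (auto simp: reparam_image_def)
        then show ?thesis unfolding im using \<delta>'(1) by simp
      qed
      moreover have "h ` A \<subseteq> M2" using C.h_in A by blast
      ultimately obtain B where B: "B \<subseteq> h ` A" "finite B" "card B < N + 1"
        "h ` A \<subseteq> flow_image Y {-\<epsilon>'<..<\<epsilon>'} B"
        using \<delta>'(2)[of "h ` A" \<beta>] by blast
      have BM: "B \<subseteq> M2" using B(1) \<open>h ` A \<subseteq> M2\<close> by blast
      show "\<exists>B\<subseteq>A. finite B \<and> card B < N + 1 \<and> A \<subseteq> flow_image X {-\<epsilon><..<\<epsilon>} B"
      proof (intro exI[of _ "k ` B"] conjI)
        show "k ` B \<subseteq> A" using B(1) kA by auto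
        show "finite (k ` B)" using B(2) by simp
        show "card (k ` B) < N + 1" using B(3) card_image_le[OF B(2), of k] by linarith
        show "A \<subseteq> flow_image X {-\<epsilon><..<\<epsilon>} (k ` B)"
        proof
          fix x assume x: "x \<in> A"
          then obtain s b where s: "h x = Y s b" "b \<in> B" "-\<epsilon>' < s" "s < \<epsilon>'"
            using B(4) imageI[OF x, of h] unfolding flow_image_def by auto
          \<comment> \<open>Applying \<open>k\<close> to \<open>h x = Y s b\<close> turns the time
            \<open>s\<close> into \<open>\<psi> s b\<close>.\<close>
          have "x = X (\<psi> s b) (k b)"
            using \<psi>(3)[of b s] kA[OF x] s(1,2) BM by auto
          moreover have "\<bar>\<psi> s b\<bar> < \<epsilon>" using s BM by (intro \<epsilon>'(2)) auto
          ultimately have "\<psi> s b \<in> {-\<epsilon><..<\<epsilon>}" "x = X (\<psi> s b) (k b)" by auto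
          then show "x \<in> flow_image X {-\<epsilon><..<\<epsilon>} (k ` B)"
            using s(2) unfolding flow_image_def by blast
        qed
      qed
    qed
  qed
qed

end
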